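(* Let $(M_n)_{n\ge1}$ be a sequence of positive real numbers satisfying conditions (0)–(3) of the context. Let $\omega\in\mathbb{R}\setminus\mathbb{Q}$, $\lambda=e^{2\pi i\omega}$, and let $(q_k)_{k\ge0}$ be the denominators of the convergents of $\omega$. Suppose that $$\limsup_{n\to+\infty}\left(\sum_{k=0}^{k(n)}\frac{\log q_{k+1}}{q_k}-\frac1n\log M_n\right)=+\infty,$$ where $k(n)$ is defined by $q_{k(n)}\le n<q_{k(n)+1}$. Let $F(z)=\lambda z+\sum_{n\ge2}f_nz^n\in z\mathbb{C}\{z\}$ with $f_2\neq0$. Define $(\tilde h_n)_{n\ge0}$ by $\tilde h_0=1$ and, for $n\ge1$, $$\tilde h_n=\frac{1}{|\lambda^n-1|}\sum_{m=2}^{n+1}|f_m|\sum_{\substack{n_1+\cdots+n_m=n+1-m\\ n_i\ge0}}\tilde h_{n_1}\cdots\tilde h_{n_m}.$$ Then the formal power series $\tilde H(z)=\sum_{n=1}^\infty\tilde h_{n-1}z^n$ does not belong to $z\mathbb{C}[[z]]_{(M_n)}$.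
   Context: Conditions on $(M_n)_{n\ge1}$: (0) $\inf_{n\ge1}M_n^{1/n}>0$; (1) there exists $C_1>0$ with $M_{n+1}\le C_1^{n+1}M_n$ for all $n\ge1$; (2) $(M_n)$ is logarithmically convex, i.e. $(M_{n+1}/M_n)_{n\ge1}$ is increasing (non-decreasing); (3) $M_nM_m\le M_{m+n-1}$ for all $m,n\ge1$. A formal series $f=\sum_{n\ge1}f_nz^n\in z\mathbb{C}[[z]]$ belongs to $z\mathbb{C}[[z]]_{(M_n)}$ if there exist $c_1,c_2>0$ such that $|f_n|\le c_1c_2^nM_n$ for all $n\ge1$. $z\mathbb{C}\{z\}$ denotes the convergent power series without constant term. Continued fractions: $a_0=\lfloor\omega\rfloor$, $\omega_0=\omega-\lfloor\omega\rfloor$, and for $n\ge1$, $a_n=\lfloor 1/\omega_{n-1}\rfloor$, $\omega_n=1/\omega_{n-1}-a_n$; the denominators of the convergents are $q_{-2}=1$, $q_{-1}=0$, $q_n=a_nq_{n-1}+q_{n-2}$ for $n\ge0$. *)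

theory Defs
  imports "HOL-Analysis.Analysis"
begin

section \<open>Continued fractions\<close>

fun cf_rem :: "real \<Rightarrow> nat \<Rightarrow> real" where
  "cf_rem \<omega> 0 = \<omega> - of_int \<lfloor>\<omega>\<rfloor>"
| "cf_rem \<omega> (Suc n) = 1 / cf_rem \<omega> n - of_int \<lfloor>1 / cf_rem \<omega> n\<rfloor>"

fun cf_quot :: "real \<Rightarrow> nat \<Rightarrow> int" where
  "cf_quot \<omega> 0 = \<lfloor>\<omega>\<rfloor>"
| "cf_quot \<omega> (Suc n) = \<lfloor>1 / cf_rem \<omega> n\<rfloor>"

text \<open>The denominators start at index \<open>-2\<close>, so \<open>cf_denom_shifted \<omega> n\<close> is \<open>q\<^sub>n\<^sub>-\<^sub>2\<close>.\<close>

fun cf_denom_shifted :: "real \<Rightarrow> nat \<Rightarrow> int" where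
  "cf_denom_shifted \<omega> 0 = 1"
| "cf_denom_shifted \<omega> (Suc 0) = 0"
| "cf_denom_shifted \<omega> (Suc (Suc n)) =
     cf_quot \<omega> n * cf_denom_shifted \<omega> (Suc n) + cf_denom_shifted \<omega> n"

definition cf_denom :: "real \<Rightarrow> nat \<Rightarrow> int" where
  "cf_denom \<omega> n = cf_denom_shifted \<omega> (n + 2)"


section \<open>Weight sequences and classes of formal power series\<close>

text \<open>Sequences are indexed by \<open>n \<ge> 1\<close>; the value \<open>M 0\<close> is never used.\<close>

definition weight_sequence :: "(nat \<Rightarrow> real) \<Rightarrow> bool" where
  "weight_sequence M \<longleftrightarrow>
     (\<forall>n\<ge>1. M n > 0) \<and>
     (INF n\<in>{1..}. M n powr (1 / real n)) > 0 \<and>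
     (\<exists>C>0. \<forall>n\<ge>1. M (n + 1) \<le> C ^ (n + 1) * M n) \<and>
     mono_on {1..} (\<lambda>n. M (n + 1) / M n) \<and>
     (\<forall>m\<ge>1. \<forall>n\<ge>1. M n * M m \<le> M (m + n - 1))"

definition fps_class :: "(nat \<Rightarrow> real) \<Rightarrow> complex fps set" where
  "fps_class M = {f. fps_nth f 0 = 0 \<and>
     (\<exists>c1>0. \<exists>c2>0. \<forall>n\<ge>1. cmod (fps_nth f n) \<le> c1 * c2 ^ n * M n)}"

definition convergent_fps0 :: "complex fps set" where
  "convergent_fps0 = {f. fps_nth f 0 = 0 \<and> fps_conv_radius f > 0}"

end

theory Submission
  imports Defs
begin

text \<open>
  The coefficient \<open>h n\<close> is a sum of nonnegative contributions of trees of size \<open>n\<close>, where a node with \<open>m\<close>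
  children counts \<open>m - 1\<close> for the size and contributes \<open>cmod (fps_nth F m) / cmod (l ^ j - 1)\<close>
  when its subtree has size \<open>j\<close>.  In binary trees, the size is the number of nodes.  It suffices to exhibit, for
  \<open>n = q\<^sub>k\<close>, a single binary tree with enough small divisors: the claim is
  \<open>ln (h (q\<^sub>k)) \<ge> q\<^sub>k (B\<^sub>k - C)\<close>, where \<open>B\<^sub>k\<close> is the sum of \<open>ln q\<^sub>j\<^sub>+\<^sub>1 / q\<^sub>j\<close> over \<open>j \<le> k\<close> and \<open>C\<close> is
  a constant.  The constant in front of \<open>B\<^sub>k\<close> has to be exactly \<open>1\<close>, as \<open>B\<^sub>k\<close> is
  compared with \<open>ln (M n) / n\<close> up to a bounded error.

  The small divisors come from the convergents: \<open>cmod (l ^ (m q\<^sub>k) - 1) \<le> 2 \<pi> m / q\<^sub>k\<^sub>+\<^sub>1\<close>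
  (\<open>small_divisor_bound\<close>).  So the tree should have about \<open>n / q\<^sub>k\<close> nodes whose sizes are multiples
  of \<open>q\<^sub>k\<close>, for all \<open>k\<close> at once.  For one \<open>k\<close> these nodes form a balanced binary tree, which keeps the
  product of the factors \<open>m\<close> exponentially bounded (\<open>resonant_tree\<close>).  The \<open>q\<^sub>k - 2\<close> free nodes
  that belong to each of them are filled with a tree that is good for the smaller denominators.
  The losses from one level to the next form a convergent series, because the denominators
  grow geometrically (\<open>lower_bound\<close>, \<open>ln_g_at_q\<close>).

  If the majorant series were in the class of \<open>M\<close>, the lower bound would give
  \<open>B\<^sub>k \<le> ln (M (q\<^sub>k)) / q\<^sub>k + O(1)\<close>.  By logarithmic convexity \<open>ln (M n) / n\<close> is nondecreasing up to a
  bounded error (\<open>log_convex_ln_mean_mono\<close>), so \<open>q\<^sub>k\<close> can be replaced on the right by every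
  \<open>n \<ge> q\<^sub>k\<close>, which contradicts the assumption on the upper limit.
\<close>

section \<open>Best approximation by the convergents\<close>

fun cf_num_shifted :: "real \<Rightarrow> nat \<Rightarrow> int" where
  "cf_num_shifted \<omega> 0 = 0"
| "cf_num_shifted \<omega> (Suc 0) = 1"
| "cf_num_shifted \<omega> (Suc (Suc n)) =
     cf_quot \<omega> n * cf_num_shifted \<omega> (Suc n) + cf_num_shifted \<omega> n"

text \<open>
  The signed error \<open>q \<omega> - p\<close> of a convergent \<open>p / q\<close>.  With the shifted indices, \<open>cf_err \<omega> 0 = \<omega>\<close> and
  \<open>cf_err \<omega> 1 = -1\<close>, and the convergent with index \<open>k\<close> is at position \<open>k + 2\<close>.
\<close>

definition cf_err :: "real \<Rightarrow> nat \<Rightarrow> real" where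
  "cf_err \<omega> n = of_int (cf_denom_shifted \<omega> n) * \<omega> - of_int (cf_num_shifted \<omega> n)"

lemma frac_pos_lt_1:
  fixes x :: real
  assumes "x \<notin> \<rat>"
  shows "x - of_int \<lfloor>x\<rfloor> \<notin> \<rat>" "0 < x - of_int \<lfloor>x\<rfloor>" "x - of_int \<lfloor>x\<rfloor> < 1"
proof -
  show n: "x - of_int \<lfloor>x\<rfloor> \<notin> \<rat>"
    using assms by (metis Rats_add Rats_of_int diff_add_cancel)
  then have "x - of_int \<lfloor>x\<rfloor> \<noteq> 0" by (metis Rats_0)
  then show "0 < x - of_int \<lfloor>x\<rfloor>" using of_int_floor_le[of x] by linarith
  show "x - of_int \<lfloor>x\<rfloor> < 1" using floor_correct[of x] by linarith
qed

lemma cf_rem_irrational: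
  assumes "\<omega> \<notin> \<rat>"
  shows "cf_rem \<omega> n \<notin> \<rat> \<and> 0 < cf_rem \<omega> n \<and> cf_rem \<omega> n < 1"
proof (induction n)
  case 0
  show ?case using frac_pos_lt_1[OF assms] by simp
next
  case (Suc n)
  then have "1 / cf_rem \<omega> n \<notin> \<rat>"
    by (metis Rats_divide Rats_1 divide_divide_eq_right mult_1 div_by_1)
  from frac_pos_lt_1[OF this] show ?case by simp
qed

lemma cf_quot_pos:
  assumes "\<omega> \<notin> \<rat>"
  shows "cf_quot \<omega> (Suc n) \<ge> 1"
proof -
  have "1 / cf_rem \<omega> n \<ge> 1" using cf_rem_irrational[OF assms, of n] by simp
  then show ?thesis by (simp add: le_floor_iff)
qed

lemma cf_err_Suc:
  assumes "\<omega> \<notin> \<rat>"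
  shows "cf_err \<omega> (Suc (Suc n)) = - cf_rem \<omega> n * cf_err \<omega> (Suc n)"
proof (induction n)
  case 0
  show ?case by (simp add: cf_err_def)
next
  case (Suc n)
  have nz: "cf_rem \<omega> n \<noteq> 0" using cf_rem_irrational[OF assms, of n] by simp
  have "cf_err \<omega> (Suc (Suc (Suc n)))
      = of_int (cf_quot \<omega> (Suc n)) * cf_err \<omega> (Suc (Suc n)) + cf_err \<omega> (Suc n)"
    by (simp add: cf_err_def algebra_simps)
  also have "cf_err \<omega> (Suc n) = - cf_err \<omega> (Suc (Suc n)) / cf_rem \<omega> n"
    using Suc nz by simp
  finally show ?case by (simp add: algebra_simps)
qed

lemma cf_det:
  "of_int (cf_denom_shifted \<omega> (Suc n)) * cf_err \<omega> n
     - of_int (cf_denom_shifted \<omega> n) * cf_err \<omega> (Suc n) = (-1) ^ n"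
proof (induction n)
  case 0
  show ?case by (simp add: cf_err_def)
next
  case (Suc n)
  have "cf_err \<omega> (Suc (Suc n)) = of_int (cf_quot \<omega> n) * cf_err \<omega> (Suc n) + cf_err \<omega> n"
    by (simp add: cf_err_def algebra_simps)
  with Suc show ?case by (simp add: algebra_simps)
qed

lemma cf_denom_simps:
  "cf_denom \<omega> 0 = 1" "cf_denom \<omega> (Suc 0) = cf_quot \<omega> (Suc 0)"
  "cf_denom \<omega> (Suc (Suc n)) = cf_quot \<omega> (Suc (Suc n)) * cf_denom \<omega> (Suc n) + cf_denom \<omega> n"
  by (simp_all add: cf_denom_def)

lemma cf_denom_mono_pos:
  assumes "\<omega> \<notin> \<rat>"
  shows "1 \<le> cf_denom \<omega> n \<and> cf_denom \<omega> n \<le> cf_denom \<omega> (Suc n)"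
proof (induction n)
  case 0
  show ?case using cf_quot_pos[OF assms, of 0] by (simp add: cf_denom_simps del: cf_quot.simps)
next
  case (Suc n)
  have "1 * cf_denom \<omega> (Suc n) \<le> cf_quot \<omega> (Suc (Suc n)) * cf_denom \<omega> (Suc n)"
    using cf_quot_pos[OF assms, of "Suc n"] Suc by (intro mult_right_mono) auto
  with Suc show ?case unfolding cf_denom_simps(3) by linarith
qed

lemma cf_denom_double:
  assumes "\<omega> \<notin> \<rat>"
  shows "2 * cf_denom \<omega> n \<le> cf_denom \<omega> (Suc (Suc n))"
proof -
  have "1 * cf_denom \<omega> (Suc n) \<le> cf_quot \<omega> (Suc (Suc n)) * cf_denom \<omega> (Suc n)"
    using cf_quot_pos[OF assms, of "Suc n"] cf_denom_mono_pos[OF assms, of "Suc n"]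
    by (intro mult_right_mono) auto
  with cf_denom_mono_pos[OF assms, of n] show ?thesis
    unfolding cf_denom_simps(3) by linarith
qed

text \<open>
  Consecutive errors have opposite signs, so the two terms of the determinant
  \<open>q\<^sub>k\<^sub>+\<^sub>1 \<epsilon>\<^sub>k - q\<^sub>k \<epsilon>\<^sub>k\<^sub>+\<^sub>1 = \<plusminus>1\<close> have equal sign and each of them is at most \<open>1\<close> in absolute value.
\<close>

lemma cf_err_bound:
  assumes "\<omega> \<notin> \<rat>"
  shows "of_int (cf_denom \<omega> (Suc k)) * \<bar>cf_err \<omega> (k + 2)\<bar> \<le> 1"
proof -
  let ?d = "cf_err \<omega> (k + 2)" and ?r = "cf_rem \<omega> (Suc k)"
  let ?A = "of_int (cf_denom \<omega> (Suc k)) + of_int (cf_denom \<omega> k) * ?r :: real"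
  have "?A * ?d = (-1) ^ (k + 2)"
    using cf_det[of \<omega> "k + 2"] cf_err_Suc[OF assms, of "Suc k"]
    by (simp add: cf_denom_def algebra_simps del: cf_rem.simps cf_denom_shifted.simps)
  then have "\<bar>?A\<bar> * \<bar>?d\<bar> = 1" by (metis abs_mult power_abs abs_minus_cancel abs_1 power_one)
  moreover have "of_int (cf_denom \<omega> (Suc k)) \<le> \<bar>?A\<bar>"
    using cf_rem_irrational[OF assms, of "Suc k"] cf_denom_mono_pos[OF assms, of k]
    by (intro order.trans[OF _ abs_ge_self]) (simp del: cf_rem.simps)
  ultimately show ?thesis by (metis mult_right_mono abs_ge_zero)
qed

lemma small_divisor_bound:
  assumes "\<omega> \<notin> \<rat>" and l: "l = exp (2 * of_real pi * \<i> * of_real \<omega>)"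
    and "n = m * nat (cf_denom \<omega> k)"
  shows "cmod (l ^ n - 1) \<le> 2 * pi * real m / of_int (cf_denom \<omega> (Suc k))"
proof -
  let ?d = "cf_err \<omega> (k + 2)" and ?p = "cf_num_shifted \<omega> (k + 2)" and ?q = "cf_denom \<omega> k"
  have q: "1 \<le> ?q" "1 \<le> cf_denom \<omega> (Suc k)" using cf_denom_mono_pos[OF assms(1)] by auto
  have n: "real n = real m * of_int ?q" using assms(3) q by simp
  have "real n * \<omega> = real m * ?d + of_int (int m * ?p)"
    unfolding n by (simp add: cf_err_def cf_denom_def algebra_simps del: cf_denom_shifted.simps cf_num_shifted.simps)
  then have eq: "of_nat n * (of_real \<omega> :: complex) = of_real (real m * ?d) + of_int (int m * ?p)"
    by (metis of_real_add of_real_mult of_real_of_int_eq of_real_of_nat_eq)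
  have "l ^ n = exp (2 * of_real pi * \<i> * (of_nat n * of_real \<omega>))"
    unfolding l exp_of_nat_mult[symmetric] by (simp add: algebra_simps)
  also have "\<dots> = exp (\<i> * of_real (2 * pi * (real m * ?d))) * exp (2 * of_real pi * \<i> * of_int (int m * ?p))"
    unfolding eq exp_add[symmetric] by (simp add: algebra_simps)
  also have "exp (2 * of_real pi * \<i> * of_int (int m * ?p)) = 1"
    using exp_integer_2pi[of "of_int (int m * ?p)"] by (simp add: mult_ac)
  finally have "l ^ n = exp (\<i> * of_real (2 * pi * (real m * ?d)))" by simp
  then have "cmod (l ^ n - 1) \<le> \<bar>2 * pi * (real m * ?d)\<bar>"
    using dist_exp_i_1[of "2 * pi * (real m * ?d)"] abs_sin_x_le_abs_x[of "2 * pi * (real m * ?d) / 2"]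
    by simp
  also have "\<dots> = 2 * pi * real m * \<bar>?d\<bar>" by (simp add: abs_mult)
  also have "\<dots> \<le> 2 * pi * real m * (1 / of_int (cf_denom \<omega> (Suc k)))"
    using cf_err_bound[OF assms(1), of k] q
    by (intro mult_left_mono) (auto simp: field_simps)
  finally show ?thesis by simp
qed

lemma unit_root_nonresonant:
  assumes "\<omega> \<notin> \<rat>" and l: "l = exp (2 * of_real pi * \<i> * of_real \<omega>)" and "n \<ge> 1"
  shows "l ^ n \<noteq> 1"
proof
  assume "l ^ n = 1"
  then have "exp (of_nat n * (2 * of_real pi * \<i> * of_real \<omega>)) = 1"
    unfolding l by (simp add: exp_of_nat_mult)
  then obtain z :: int where z: "real n * (2 * pi * \<omega>) = of_int (2 * z) * pi"
    by (auto simp: exp_eq_1)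
  then have "real n * \<omega> = of_int z" by (simp add: algebra_simps)
  then have "\<omega> = of_int z / of_nat n" using \<open>n \<ge> 1\<close> by (simp add: field_simps)
  then show False using assms(1) by (metis Rats_divide Rats_of_int Rats_of_nat)
qed

section \<open>Growth forced by resonances\<close>

text \<open>
  The axioms record what the recursion gives for the growth of binary trees: joining trees with
  \<open>a\<close> and \<open>b\<close> nodes under a new root yields \<open>a + b + 1\<close> nodes, and the root contributes a large
  factor when its size is a multiple of some \<open>q k\<close>.  The sequence \<open>q\<close> stands for the denominators.
\<close>

locale resonant_growth =
  fixes g :: "nat \<Rightarrow> real" and q :: "nat \<Rightarrow> nat"
  assumes g_0: "g 0 = 1"
    and g_join: "g a * g b \<le> g (Suc (a + b))"
    and g_resonance: "Suc (a + b) = m * q k \<Longrightarrow>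
      real (q (Suc k)) / (4 * real m) * (g a * g b) \<le> g (Suc (a + b))"
    and q_pos: "1 \<le> q k"
    and q_Suc: "q k \<le> q (Suc k)"
    and q_double: "2 * q k \<le> q (Suc (Suc k))"
begin

lemma g_mono: "mono g"
  unfolding mono_iff_le_Suc using g_join[of _ 0] g_0 by simp

lemma g_ge_1: "1 \<le> g n"
  using monoD[OF g_mono, of 0 n] g_0 by simp

lemma q_mono: "j \<le> k \<Longrightarrow> q j \<le> q k"
  using lift_Suc_mono_le[of q, OF q_Suc] by blast

text \<open>
  The tree is chosen so that as many roots as possible are resonant: \<open>m\<close> resonant nodes of sizes that are
  multiples of \<open>q k\<close> are arranged as a balanced binary tree, and each of them brings one filler
  subtree of size \<open>q k - 2\<close> and one extra node, which makes the sizes match with no node left over.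
  A resonant node of size \<open>j q k\<close> pays a factor \<open>1 / j\<close>.  A chain of resonant nodes would accumulate
  \<open>1 / m!\<close>, which is too much when \<open>m\<close> is near \<open>q (Suc k) / q k\<close>; joining separate copies of size \<open>q k\<close>
  would waste a node per copy.  For the balanced tree the product of the \<open>1 / j\<close> is only
  exponentially small in \<open>m\<close>, which the constant \<open>64 = 4 * 16\<close> absorbs.  The factor
  \<open>(m + 1)\<^sup>2\<close> strengthens the induction: it outgrows the factor \<open>1 / m\<close> of the root because
  \<open>(i + 1) (j + 1) \<ge> m (m + 2) / 4\<close> for the two halves.  For \<open>q k = 1\<close> the truncated
  difference \<open>q k - 2 = 0\<close> denotes the empty filler, with factor \<open>g 0 = 1\<close>.
\<close>

lemma resonant_tree:
  "(real m + 1)\<^sup>2 * (real (q (Suc k)) * g (q k - 2) / 64) ^ m \<le> g (m * q k)"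
proof (induction m rule: less_induct)
  case (less m)
  define G where "G = g (q k - 2)"
  define Y where "Y = real (q (Suc k)) * G / 64"
  have G: "1 \<le> G" by (simp add: G_def g_ge_1)
  have Y: "0 < Y" using G q_pos[of "Suc k"] by (simp add: Y_def)
  show ?case
  proof (cases "m = 0")
    case True
    then show ?thesis by (simp add: g_0)
  next
    case False
    \<comment> \<open>Split the remaining \<open>m - 1\<close> resonant nodes evenly; the filler goes into the second subtree.\<close>
    define i where "i = (m - 1) div 2"
    define j where "j = m - 1 - i"
    have ij: "m = Suc (i + j)" using False by (simp add: i_def j_def)
    have near: "i = j \<or> j = Suc i" unfolding i_def j_def by linarith
    define b where "b = j * q k + (q k - 1)"
    have mb: "Suc (i * q k + b) = m * q k"
      using q_pos[of k] by (simp add: b_def ij algebra_simps)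
    have "g (j * q k) * G \<le> g b"
    proof (cases "q k = 1")
      case True
      then show ?thesis by (simp add: b_def G_def g_0)
    next
      case False
      then have "b = Suc (j * q k + (q k - 2))" using q_pos[of k] by (simp add: b_def)
      then show ?thesis using g_join by (simp add: G_def)
    qed
    moreover have "(real j + 1)\<^sup>2 * Y ^ j \<le> g (j * q k)"
      using less[of j] ij by (simp add: Y_def G_def)
    ultimately have gb: "(real j + 1)\<^sup>2 * Y ^ j * G \<le> g b"
      using G by (meson mult_right_mono order.trans zero_le_one)
    have ga: "(real i + 1)\<^sup>2 * Y ^ i \<le> g (i * q k)"
      using less[of i] ij by (simp add: Y_def G_def)
    have m: "0 < real m" using False by simp
    have prod: "real m * (real m + 2) / 4 \<le> (real i + 1) * (real j + 1)"
      using near by (auto simp: ij field_simps)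
    have "(real m + 1)\<^sup>2 * Y ^ m \<le> real m * (real m + 2)\<^sup>2 * Y ^ m"
    proof (intro mult_right_mono)
      have "(real m + 1)\<^sup>2 \<le> 1 * (real m + 2)\<^sup>2" by (simp add: power_mono)
      also have "\<dots> \<le> real m * (real m + 2)\<^sup>2" using False by (intro mult_right_mono) auto
      finally show "(real m + 1)\<^sup>2 \<le> real m * (real m + 2)\<^sup>2" .
    qed (use Y in simp)
    also have "\<dots> = 16 / real m * (real m * (real m + 2) / 4)\<^sup>2 * Y ^ m"
      using m by (simp add: field_simps power2_eq_square)
    also have "\<dots> \<le> 16 / real m * ((real i + 1) * (real j + 1))\<^sup>2 * Y ^ m"
      using prod Y m by (intro mult_right_mono mult_left_mono power_mono) auto
    also have "\<dots> = 64 * Y / (4 * real m) *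
        (((real i + 1)\<^sup>2 * Y ^ i) * ((real j + 1)\<^sup>2 * Y ^ j))"
    proof -
      have "Y ^ m = Y * Y ^ i * Y ^ j" by (simp add: ij power_add)
      then show ?thesis by (simp add: power_mult_distrib)
    qed
    also have "64 * Y = real (q (Suc k)) * G" by (simp add: Y_def)
    also have "real (q (Suc k)) * G / (4 * real m) *
          (((real i + 1)\<^sup>2 * Y ^ i) * ((real j + 1)\<^sup>2 * Y ^ j))
        = real (q (Suc k)) / (4 * real m) *
          (((real i + 1)\<^sup>2 * Y ^ i) * ((real j + 1)\<^sup>2 * Y ^ j * G))"
      by simp
    also have "\<dots> \<le> real (q (Suc k)) / (4 * real m) * (g (i * q k) * g b)"
      using ga gb Y G order.trans[OF zero_le_one g_ge_1]
      by (intro mult_left_mono mult_mono) auto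
    also have "\<dots> \<le> g (m * q k)"
      using g_resonance[OF mb] by (simp only: mb)
    finally show ?thesis by (simp add: Y_def G_def)
  qed
qed

lemma ln_resonant_tree:
  "real m * (ln (real (q (Suc k))) - ln 64 + ln (g (q k - 2))) \<le> ln (g (m * q k))"
proof -
  define Y where "Y = real (q (Suc k)) * g (q k - 2) / 64"
  have g: "0 < g (q k - 2)" using g_ge_1[of "q k - 2"] by simp
  then have Y: "0 < Y" using q_pos[of "Suc k"] by (simp add: Y_def)
  have "Y ^ m \<le> (real m + 1)\<^sup>2 * Y ^ m" using Y by simp
  also have "\<dots> \<le> g (m * q k)" using resonant_tree by (simp add: Y_def)
  finally have "ln (Y ^ m) \<le> ln (g (m * q k))" using Y by (intro ln_mono) auto
  moreover have "ln Y = ln (real (q (Suc k))) - ln 64 + ln (g (q k - 2))"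
    using g q_pos[of "Suc k"] by (simp add: Y_def ln_mult ln_div)
  ultimately show ?thesis using Y by (simp add: ln_realpow)
qed

text \<open>
  All error terms are measured by the fourth root of \<open>q k\<close>: the logarithms, hence the Brjuno sums,
  are \<open>O(t k)\<close>, and the doubling \<open>q (k + 2) \<ge> 2 q k\<close> makes \<open>1 / t k\<close> summable.
\<close>

definition t :: "nat \<Rightarrow> real" where "t k = root 4 (real (q k))"

lemma t_pow: "t k ^ 4 = real (q k)"
  by (simp add: t_def)

lemma t_ge_1: "1 \<le> t k"
  using q_pos[of k] by (simp add: t_def)

lemma t_mono: "j \<le> k \<Longrightarrow> t j \<le> t k"
  using q_mono[of j k] by (simp add: t_def)

lemma ln_q_le: "ln (real (q k)) \<le> 4 * t k"
proof -
  have "ln (real (q k)) = 4 * ln (t k)"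
    using q_pos[of k] by (simp add: t_def ln_root)
  also have "\<dots> \<le> 4 * t k" using t_ge_1[of k] ln_le_minus_one[of "t k"] by simp
  finally show ?thesis .
qed

lemma summable_inverse_t: "summable (\<lambda>k. 1 / t k)"
proof -
  define r :: real where "r = root 8 2"
  have r8: "r ^ 8 = 2" and r1: "1 < r" by (simp_all add: r_def)
  have q: "r ^ (4 * k) \<le> 2 * real (q k)" for k
  proof (induction k rule: induct_nat_012)
    case 0
    show ?case using q_pos[of 0] by simp
  next
    case 1
    have "r ^ 4 \<le> r ^ 8" using r1 by (intro power_increasing) auto
    then show ?case using r8 q_pos[of 1] by simp
  next
    case (ge2 k)
    have "r ^ (4 * Suc (Suc k)) = r ^ (4 * k) * r ^ 8" by (simp add: ac_simps flip: power_add)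
    then show ?case using ge2(1) q_double[of k] r8 by simp
  qed
  have bound: "1 / t k \<le> 2 * (1 / r) ^ k" for k
  proof -
    have "(r ^ k / 2) ^ 4 = r ^ (4 * k) / 16" by (simp add: power_divide power_mult mult.commute)
    also have "\<dots> \<le> t k ^ 4" using q[of k] by (simp add: t_pow)
    finally have "r ^ k / 2 \<le> t k"
      using t_ge_1[of k] r1 by (subst (asm) power_mono_iff) auto
    then show ?thesis using r1 t_ge_1[of k] by (simp add: field_simps)
  qed
  have "summable (\<lambda>k. 2 * (1 / r) ^ k)" using r1 by (intro summable_mult summable_geometric) auto
  moreover have "\<exists>N. \<forall>n\<ge>N. norm (1 / t n) \<le> 2 * (1 / r) ^ n"
    using bound t_ge_1 by (auto intro!: exI[of _ 0] simp: order.trans[OF zero_le_one t_ge_1])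
  ultimately show ?thesis by (rule summable_comparison_test[rotated])
qed

definition inverse_t_total :: real where "inverse_t_total = (\<Sum>k. 1 / t k)"

lemma sum_inverse_t_le: "(\<Sum>j<k. 1 / t j) \<le> inverse_t_total"
  unfolding inverse_t_total_def using t_ge_1
  by (intro sum_le_suminf summable_inverse_t) (auto simp: order.trans[OF zero_le_one t_ge_1])

lemma inverse_t_total_nonneg: "0 \<le> inverse_t_total"
  using sum_inverse_t_le[of 0] by simp

definition brjuno :: "nat \<Rightarrow> real" where
  "brjuno k = (\<Sum>j<k. ln (real (q (Suc j))) / real (q j))"

lemma brjuno_nonneg: "0 \<le> brjuno k"
  unfolding brjuno_def using q_pos by (intro sum_nonneg divide_nonneg_nonneg) auto

lemma brjuno_mono: "brjuno k \<le> brjuno (Suc k)"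
  using q_pos[of "Suc k"] by (simp add: brjuno_def)

lemma brjuno_le: "brjuno k \<le> 4 * inverse_t_total * t k"
proof -
  have "brjuno k \<le> (\<Sum>j<k. 4 * t k * (1 / t j))"
    unfolding brjuno_def
  proof (intro sum_mono)
    fix j assume "j \<in> {..<k}"
    then have "q (Suc j) \<le> q k" by (intro q_mono) auto
    then have "ln (real (q (Suc j))) \<le> 4 * t k"
      using q_pos[of "Suc j"] by (intro order.trans[OF ln_mono ln_q_le]) auto
    moreover have "1 / real (q j) \<le> 1 / t j"
      using t_ge_1[of j] self_le_power[of "t j" 4] by (simp add: t_pow frac_le)
    ultimately have "ln (real (q (Suc j))) * (1 / real (q j)) \<le> 4 * t k * (1 / t j)"
      using t_ge_1[of k] by (intro mult_mono) auto
    then show "ln (real (q (Suc j))) / real (q j) \<le> 4 * t k * (1 / t j)" by simp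
  qed
  also have "\<dots> = 4 * t k * (\<Sum>j<k. 1 / t j)" by (simp add: sum_distrib_left)
  also have "\<dots> \<le> 4 * t k * inverse_t_total" using t_ge_1[of k] sum_inverse_t_le[of k] by (intro mult_left_mono) auto
  finally show ?thesis by (simp add: algebra_simps)
qed

text \<open>
  One level costs at most \<open>loss_rate / t k\<close> per node.  The constant has to satisfy
  \<open>ln 64 + 2 brjuno k + (t k)\<^sup>2 brjuno k \<le> loss_rate * (t k) ^ 3\<close>, where
  \<open>brjuno k \<le> 4 * inverse_t_total * t k\<close>.
\<close>

definition loss_rate :: real where "loss_rate = 64 + 12 * inverse_t_total"

definition loss :: "nat \<Rightarrow> real" where "loss k = (\<Sum>j<k. loss_rate / t j)"

lemma loss_nonneg: "0 \<le> loss k"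
  unfolding loss_def loss_rate_def using inverse_t_total_nonneg t_ge_1
  by (intro sum_nonneg divide_nonneg_nonneg) (auto intro: order.trans[OF zero_le_one])

lemma loss_le: "loss k \<le> loss_rate * inverse_t_total"
proof -
  have "loss k = loss_rate * (\<Sum>j<k. 1 / t j)" by (simp add: loss_def sum_distrib_left)
  then show ?thesis using sum_inverse_t_le[of k] inverse_t_total_nonneg by (simp add: loss_rate_def mult_left_mono)
qed

text \<open>
  The left-over nodes of each resonant block carry a tree that is already good for the smaller
  denominators, so one more level adds \<open>ln (q (Suc k)) / q k\<close> to the growth rate
  without giving up the rate reached before.  The price consists of the constant \<open>ln 64\<close>, the two
  nodes per block that the filler lacks, and the additive error of the previous bound.
\<close>

lemma resonance_gain:
  assumes lower: "\<And>n. (brjuno k - loss k) * real n - (t k)\<^sup>2 * brjuno k \<le> ln (g n)"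
  shows "real (q k) * (brjuno (Suc k) - loss (Suc k))
           \<le> ln (real (q (Suc k))) - ln 64 + ln (g (q k - 2))"
proof -
  let ?D = "brjuno k - loss k"
  have t: "1 \<le> t k" "0 \<le> t k" using t_ge_1[of k] by auto
  have B: "0 \<le> brjuno k" by (rule brjuno_nonneg)
  have filler: "real (q k) * ?D - 2 * brjuno k - (t k)\<^sup>2 * brjuno k \<le> ln (g (q k - 2))"
  proof (cases "0 \<le> ?D")
    case True
    have "(real (q k) - 2) * ?D \<le> real (q k - 2) * ?D"
      using True by (intro mult_right_mono) auto
    then show ?thesis using lower[of "q k - 2"] loss_nonneg[of k] by (simp add: algebra_simps)
  next
    case False
    then have "real (q k) * ?D \<le> 0" by (simp add: mult_nonneg_nonpos)
    moreover have "0 \<le> ln (g (q k - 2))" using g_ge_1 by simp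
    moreover have "0 \<le> (t k)\<^sup>2 * brjuno k" using B by simp
    ultimately show ?thesis using B by linarith
  qed
  have "ln 64 + 2 * brjuno k + (t k)\<^sup>2 * brjuno k \<le> loss_rate * t k ^ 3"
  proof -
    have "(2 + (t k)\<^sup>2) * brjuno k \<le> (3 * (t k)\<^sup>2) * (4 * inverse_t_total * t k)"
      using t B brjuno_le[of k] one_le_power[of "t k" 2] by (intro mult_mono) auto
    moreover have "(ln 64 :: real) \<le> 64 * t k ^ 3"
      using ln_le_minus_one[of "64::real"] one_le_power[of "t k" 3] t by linarith
    ultimately show ?thesis by (simp add: loss_rate_def algebra_simps power2_eq_square power3_eq_cube)
  qed
  also have "\<dots> = real (q k) * (loss_rate / t k)"
    using t by (simp add: t_pow[symmetric] power_numeral_reduce)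
  finally have cost: "ln 64 + 2 * brjuno k + (t k)\<^sup>2 * brjuno k \<le> real (q k) * (loss_rate / t k)" .
  have "real (q k) * (brjuno (Suc k) - loss (Suc k))
      = real (q k) * ?D + ln (real (q (Suc k))) - real (q k) * (loss_rate / t k)"
    using q_pos[of k] by (simp add: brjuno_def loss_def algebra_simps)
  with filler cost show ?thesis by linarith
qed

text \<open>
  The bound is linear in \<open>n\<close>, so rounding \<open>n\<close> down to a multiple of \<open>q k\<close> costs \<open>q k\<close> times the rate.
  This would be too expensive if it happened at every level, as consecutive denominators may
  be comparable.  It is done only when \<open>q (Suc k) \<ge> (q k)\<^sup>2\<close>, where \<open>q k\<close> is at most
  \<open>(t (Suc k))\<^sup>2\<close>, the square root of the next denominator.  At the other levels
  \<open>ln (q (Suc k)) / q k \<le> 2 ln (q k) / q k\<close> is so small that the term can be put into the loss.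
\<close>

lemma lower_bound:
  "(brjuno k - loss k) * real n - (t k)\<^sup>2 * brjuno k \<le> ln (g n)"
proof (induction k arbitrary: n)
  case 0
  then show ?case using g_ge_1 by (simp add: brjuno_def loss_def)
next
  case (Suc k)
  let ?D = "brjuno (Suc k) - loss (Suc k)"
  have t: "1 \<le> t k" "0 \<le> t k" using t_ge_1[of k] by auto
  show ?case
  proof (cases "q (Suc k) < (q k)\<^sup>2")
    case True
    have "ln (real (q (Suc k))) \<le> ln ((real (q k))\<^sup>2)"
      using True q_pos[of "Suc k"] by (intro ln_mono) (simp_all flip: of_nat_power)
    also have "\<dots> = 2 * ln (real (q k))" using q_pos[of k] by (simp add: ln_realpow)
    also have "\<dots> \<le> 8 * t k" using ln_q_le[of k] by simp
    also have "\<dots> \<le> loss_rate * t k ^ 3"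
      using inverse_t_total_nonneg t self_le_power[of "t k" 3] by (intro mult_mono) (auto simp: loss_rate_def)
    finally have "ln (real (q (Suc k))) / real (q k) \<le> loss_rate / t k"
      using t q_pos[of k] by (simp add: t_pow[symmetric] field_simps power_numeral_reduce)
    then have "?D \<le> brjuno k - loss k" by (simp add: brjuno_def loss_def)
    then have "?D * real n \<le> (brjuno k - loss k) * real n" by (intro mult_right_mono) auto
    moreover have "(t k)\<^sup>2 * brjuno k \<le> (t (Suc k))\<^sup>2 * brjuno (Suc k)"
      using t brjuno_nonneg[of k] brjuno_mono[of k] t_mono[of k "Suc k"]
      by (intro mult_mono power_mono) auto
    ultimately show ?thesis using Suc[of n] by linarith
  next
    case False
    have "(real (q k))\<^sup>2 \<le> real (q (Suc k))" using False by (simp flip: of_nat_power)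
    also have "\<dots> = ((t (Suc k))\<^sup>2)\<^sup>2" by (simp add: t_pow flip: power_mult)
    finally have qt: "real (q k) \<le> (t (Suc k))\<^sup>2" by (rule power2_le_imp_le) simp
    show ?thesis
    proof (cases "0 \<le> ?D")
      case neg: False
      then have "?D * real n \<le> 0" by (simp add: mult_nonpos_nonneg)
      moreover have "0 \<le> (t (Suc k))\<^sup>2 * brjuno (Suc k)" using brjuno_nonneg by simp
      moreover have "0 \<le> ln (g n)" using g_ge_1 by simp
      ultimately show ?thesis by linarith
    next
      case True
      define m where "m = n div q k"
      have mn: "m * q k \<le> n" by (simp add: m_def)
      have "n < q k + m * q k"
        using q_pos[of k] mod_less_divisor[of "q k" n] div_mult_mod_eq[of n "q k"]
        unfolding m_def by linarith
      then have nm: "real n - real (q k) \<le> real m * real (q k)"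
        by (simp flip: of_nat_mult of_nat_add)
      have "?D * real n - (t (Suc k))\<^sup>2 * brjuno (Suc k) \<le> ?D * real n - real (q k) * brjuno (Suc k)"
        using qt brjuno_nonneg[of "Suc k"] by (simp add: mult_right_mono)
      also have "\<dots> \<le> ?D * (real n - real (q k))"
        using loss_nonneg[of "Suc k"] by (simp add: algebra_simps)
      also have "\<dots> \<le> ?D * (real m * real (q k))" using True nm by (intro mult_left_mono) auto
      also have "\<dots> = real m * (real (q k) * ?D)" by simp
      also have "\<dots> \<le> real m * (ln (real (q (Suc k))) - ln 64 + ln (g (q k - 2)))"
        by (intro mult_left_mono resonance_gain Suc) auto
      also have "\<dots> \<le> ln (g (m * q k))" by (rule ln_resonant_tree)
      also have "\<dots> \<le> ln (g n)" using monoD[OF g_mono mn] g_ge_1[of "m * q k"] by simp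
      finally show ?thesis .
    qed
  qed
qed

text \<open>
  At \<open>n = q k\<close> one resonant node collects the last term of the Brjuno sum in full, with nothing
  lost to rounding, whether or not \<open>q (Suc k)\<close> is large.
\<close>

lemma ln_g_at_q: "real (q k) * (brjuno (Suc k) - loss_rate * inverse_t_total) \<le> ln (g (q k))"
proof -
  have "real (q k) * (brjuno (Suc k) - loss_rate * inverse_t_total) \<le> real (q k) * (brjuno (Suc k) - loss (Suc k))"
    using loss_le[of "Suc k"] by (intro mult_left_mono) auto
  also have "\<dots> \<le> ln (real (q (Suc k))) - ln 64 + ln (g (q k - 2))"
    by (intro resonance_gain lower_bound)
  also have "\<dots> \<le> ln (g (q k))" using ln_resonant_tree[of 1 k] by simp
  finally show ?thesis .
qed

end

section \<open>Logarithmically convex weights\<close>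

text \<open>
  The lower bound for the coefficients is available at the denominators \<open>q\<^sub>k\<close> only, while the
  divergence hypothesis allows every \<open>n\<close>.  Convexity transports the bound: \<open>\<kappa>\<close> is chosen so that the
  line through the points \<open>(1, ln (M 1) + \<kappa>)\<close> and \<open>(2, ln (M 2) + \<kappa>)\<close> passes through the origin.
  The later chords meet the vertical axis at or below the origin, so the slope of the line from the
  origin to the graph does not decrease.
\<close>

lemma log_convex_ln_mean_mono:
  fixes M :: "nat \<Rightarrow> real"
  assumes pos: "\<And>n. n \<ge> 1 \<Longrightarrow> 0 < M n"
    and conv: "mono_on {1..} (\<lambda>n. M (n + 1) / M n)"
    and "1 \<le> q" "q \<le> n"
  defines "\<kappa> \<equiv> ln (M 2) - 2 * ln (M 1)"
  shows "(ln (M q) + \<kappa>) / real q \<le> (ln (M n) + \<kappa>) / real n"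
proof -
  let ?u = "\<lambda>n. ln (M n)"
  have incr: "?u (Suc n) - ?u n \<le> ?u (Suc (Suc n)) - ?u (Suc n)" if "n \<ge> 1" for n
  proof -
    have "M (n + 1) / M n \<le> M (Suc n + 1) / M (Suc n)"
      using that by (intro mono_onD[OF conv]) auto
    then have "ln (M (n + 1) / M n) \<le> ln (M (Suc n + 1) / M (Suc n))"
      using pos[of n] pos[of "Suc n"] that by (intro ln_mono) auto
    then show ?thesis
      using pos[of n] pos[of "Suc n"] pos[of "Suc (Suc n)"] that by (simp add: ln_div)
  qed
  have tangent: "?u n + \<kappa> \<le> real n * (?u (Suc n) - ?u n)" if "n \<ge> 1" for n
    using that
  proof (induction n rule: dec_induct)
    case base
    then show ?case by (simp add: \<kappa>_def numeral_2_eq_2)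
  next
    case (step n)
    have "real (Suc n) * (?u (Suc n) - ?u n) \<le> real (Suc n) * (?u (Suc (Suc n)) - ?u (Suc n))"
      using incr[of n] step by (intro mult_left_mono) auto
    with step(3) show ?case by (simp add: algebra_simps)
  qed
  have mono: "(?u n + \<kappa>) / real n \<le> (?u (Suc n) + \<kappa>) / real (Suc n)" if "n \<ge> 1" for n
    using tangent[OF that] that by (simp add: divide_simps) (simp add: algebra_simps)
  show ?thesis
    using \<open>q \<le> n\<close>
  proof (induction n rule: dec_induct)
    case (step n)
    then show ?case using mono[of n] \<open>1 \<le> q\<close> by linarith
  qed simp
qed

section \<open>The majorant series\<close>

lemma finite_compositions: "finite {ns :: nat list. length ns = m \<and> sum_list ns = s}"
proof (rule finite_subset)
  show "{ns :: nat list. length ns = m \<and> sum_list ns = s} \<subseteq> {ns. set ns \<subseteq> {..s} \<and> length ns = m}"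
    using member_le_sum_list by fastforce
qed (simp add: finite_lists_length_eq)

locale majorant_recursion =
  fixes h :: "nat \<Rightarrow> real" and f :: "nat \<Rightarrow> real" and D :: "nat \<Rightarrow> real"
  assumes h_0: "h 0 = 1"
    and h_rec: "n \<ge> 1 \<Longrightarrow>
           h n = 1 / D n *
             (\<Sum>m=2..n+1. f m *
               (\<Sum>ns\<in>{ns :: nat list. length ns = m \<and> sum_list ns = n + 1 - m}. \<Prod>i<m. h (ns ! i)))"
    and f_nonneg: "0 \<le> f m"
    and D_nonneg: "0 \<le> D n"
begin

lemma h_nonneg: "0 \<le> h n"
proof (induction n rule: less_induct)
  case (less n)
  show ?case
  proof (cases "n = 0")
    case False
    have "0 \<le> h (ns ! i)"
      if "m \<in> {2..n+1}" "length ns = m" "sum_list ns = n + 1 - m" "i < m" for m ns i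
    proof -
      have "ns ! i \<le> sum_list ns" using that by (intro member_le_sum_list) auto
      then have "ns ! i < n" using that by auto
      then show ?thesis by (rule less)
    qed
    then show ?thesis
      using False
      by (subst h_rec)
        (auto intro!: mult_nonneg_nonneg sum_nonneg prod_nonneg f_nonneg D_nonneg divide_nonneg_nonneg
          simp del: sum.cl_ivl_Suc prod.lessThan_Suc)
  qed (simp add: h_0)
qed

text \<open>
  All terms of the recursion are nonnegative; only the trees with a binary root and subtrees of
  sizes \<open>a\<close> and \<open>b\<close> are kept.
\<close>

lemma h_join: "f 2 / D (Suc (a + b)) * (h a * h b) \<le> h (Suc (a + b))"
proof -
  let ?n = "Suc (a + b)"
  let ?T = "\<lambda>m. {ns :: nat list. length ns = m \<and> sum_list ns = ?n + 1 - m}"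
  have "(\<Prod>i<2. h ([a, b] ! i)) \<le> (\<Sum>ns\<in>?T 2. \<Prod>i<2. h (ns ! i))"
    by (rule member_le_sum[of "[a, b]"]) (auto intro: prod_nonneg h_nonneg finite_compositions)
  then have "f 2 * (h a * h b) \<le> f 2 * (\<Sum>ns\<in>?T 2. \<Prod>i<2. h (ns ! i))"
    using f_nonneg[of 2] by (intro mult_left_mono) (auto simp: numeral_2_eq_2)
  also have "\<dots> \<le> (\<Sum>m=2..?n+1. f m * (\<Sum>ns\<in>?T m. \<Prod>i<m. h (ns ! i)))"
    by (rule member_le_sum[of 2])
       (auto intro!: mult_nonneg_nonneg f_nonneg sum_nonneg prod_nonneg h_nonneg)
  finally have "1 / D ?n * (f 2 * (h a * h b)) \<le> h ?n"
    using D_nonneg[of ?n] by (subst h_rec[of ?n]) (auto intro: divide_right_mono)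
  then show ?thesis by simp
qed

end

text \<open>
  The factor \<open>(f 2 / 2) ^ n\<close> removes one \<open>f 2\<close> and one trivial divisor \<open>2\<close> per node: a binary
  tree of size \<open>n\<close> has \<open>n\<close> nodes, and \<open>cmod (l ^ j - 1) \<le> 2\<close> for all \<open>j\<close>.  After the
  normalization an arbitrary node costs nothing, and a node of size \<open>m q\<^sub>k\<close> gains
  \<open>2 / cmod (l ^ (m q\<^sub>k) - 1) \<ge> q\<^sub>k\<^sub>+\<^sub>1 / (4 m)\<close>, as \<open>\<pi> \<le> 4\<close>.
\<close>

lemma majorant_resonant_growth:
  fixes \<omega> :: real and l :: complex
  assumes irr: "\<omega> \<notin> \<rat>" and l: "l = exp (2 * of_real pi * \<i> * of_real \<omega>)"
    and maj: "majorant_recursion h f (\<lambda>n. cmod (l ^ n - 1))"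
    and f2: "0 < f 2"
  shows "resonant_growth (\<lambda>n. h n / (f 2 / 2) ^ n) (\<lambda>k. nat (cf_denom \<omega> k))"
proof -
  interpret majorant_recursion h f "\<lambda>n. cmod (l ^ n - 1)" by (rule maj)
  let ?g = "\<lambda>n. h n / (f 2 / 2) ^ n" and ?q = "\<lambda>k. nat (cf_denom \<omega> k)"
  have norm_l: "cmod l = 1" by (simp add: l norm_exp)
  have D_pos: "0 < cmod (l ^ n - 1)" if "n \<ge> 1" for n
    using unit_root_nonresonant[OF irr l that] by simp
  have D_le: "cmod (l ^ n - 1) \<le> 2" for n
    using norm_triangle_ineq4[of "l ^ n" 1] by (simp add: norm_power norm_l)
  have join: "x * (?g a * ?g b) \<le> ?g (Suc (a + b))"
    if "0 \<le> x" "x \<le> 2 / cmod (l ^ Suc (a + b) - 1)" for x a b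
  proof -
    have "x * (?g a * ?g b) \<le> 2 / cmod (l ^ Suc (a + b) - 1) * (?g a * ?g b)"
      using that h_nonneg f2 by (intro mult_right_mono) auto
    also have "\<dots> = f 2 / cmod (l ^ Suc (a + b) - 1) * (h a * h b) / (f 2 / 2) ^ Suc (a + b)"
      using f2 by (simp add: power_add)
    also have "\<dots> \<le> ?g (Suc (a + b))"
      using h_join f2 by (intro divide_right_mono) auto
    finally show ?thesis .
  qed
  have q: "1 \<le> cf_denom \<omega> k" "cf_denom \<omega> k \<le> cf_denom \<omega> (Suc k)" for k
    using cf_denom_mono_pos[OF irr] by auto
  show ?thesis
  proof
    show "?g 0 = 1" by (simp add: h_0)
    fix a b m k
    show "?g a * ?g b \<le> ?g (Suc (a + b))"
      using join[of 1 a b] D_le[of "Suc (a + b)"] D_pos[of "Suc (a + b)"] by simp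
    show "1 \<le> ?q k" "?q k \<le> ?q (Suc k)" using q[of k] by simp_all
    show "2 * ?q k \<le> ?q (Suc (Suc k))"
      using cf_denom_double[OF irr, of k] q[of k] by linarith
    assume res: "Suc (a + b) = m * ?q k"
    then have m: "0 < real m" by (cases m) auto
    have Q: "real (?q (Suc k)) = of_int (cf_denom \<omega> (Suc k))" "0 < real (?q (Suc k))"
      using q[of "Suc k"] by simp_all
    let ?D = "cmod (l ^ Suc (a + b) - 1)"
    have "?D \<le> 2 * pi * real m / real (?q (Suc k))"
      using small_divisor_bound[OF irr l res] Q by simp
    also have "\<dots> \<le> 8 * real m / real (?q (Suc k))"
      using m Q pi_less_4 by (intro divide_right_mono mult_right_mono) auto
    finally have "?D * real (?q (Suc k)) \<le> 8 * real m" using Q by (simp add: pos_le_divide_eq)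
    then have "real (?q (Suc k)) / (4 * real m) \<le> 2 / ?D"
      using m D_pos[of "Suc (a + b)"] by (simp add: field_simps)
    then show "real (?q (Suc k)) / (4 * real m) * (?g a * ?g b) \<le> ?g (Suc (a + b))"
      using m by (intro join) auto
  qed
qed

section \<open>Divergence of the majorant series\<close>

theorem mainTheorem4:
  fixes M :: "nat \<Rightarrow> real" and \<omega> :: real and l :: complex
    and k :: "nat \<Rightarrow> nat" and F :: "complex fps" and h :: "nat \<Rightarrow> real"
  assumes "weight_sequence M"
    and "\<omega> \<notin> \<rat>"
    and "l = exp (2 * of_real pi * \<i> * of_real \<omega>)"
    and "\<And>n. n \<ge> 1 \<Longrightarrow> cf_denom \<omega> (k n) \<le> int n \<and> int n < cf_denom \<omega> (k n + 1)"
    and "limsup (\<lambda>n. ereal ((\<Sum>j=0..k n. ln (real_of_int (cf_denom \<omega> (j + 1))) / real_of_int (cf_denom \<omega> j))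
                            - 1 / real n * ln (M n))) = \<infinity>"
    and "F \<in> convergent_fps0"
    and "fps_nth F 1 = l"
    and "fps_nth F 2 \<noteq> 0"
    and "h 0 = 1"
    and "\<And>n. n \<ge> 1 \<Longrightarrow>
           h n = 1 / cmod (l ^ n - 1) *
             (\<Sum>m=2..n+1. cmod (fps_nth F m) *
               (\<Sum>ns\<in>{ns :: nat list. length ns = m \<and> sum_list ns = n + 1 - m}. \<Prod>i<m. h (ns ! i)))"
  shows "Abs_fps (\<lambda>n. if n = 0 then 0 else of_real (h (n - 1))) \<notin> fps_class M"
proof
  assume cls: "Abs_fps (\<lambda>n. if n = 0 then 0 else of_real (h (n - 1))) \<in> fps_class M"
  define c where "c = cmod (fps_nth F 2) / 2"
  define q where "q = (\<lambda>k. nat (cf_denom \<omega> k))"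
  define g where "g = (\<lambda>n. h n / c ^ n)"
  have c: "0 < c" using assms(8) by (simp add: c_def)
  have q_int: "cf_denom \<omega> i = int (q i)" for i
    using cf_denom_mono_pos[OF assms(2), of i] by (simp add: q_def)
  interpret majorant_recursion h "\<lambda>m. cmod (fps_nth F m)" "\<lambda>n. cmod (l ^ n - 1)"
    by unfold_locales (use assms(9,10) in auto)
  interpret resonant_growth g q
    using majorant_resonant_growth[OF assms(2,3) majorant_recursion_axioms] assms(8)
    by (simp add: g_def q_def c_def)
  have M_pos: "0 < M n" if "n \<ge> 1" for n
    using assms(1) that by (simp add: weight_sequence_def)
  have M_conv: "mono_on {1..} (\<lambda>n. M (n + 1) / M n)"
    using assms(1) by (simp add: weight_sequence_def)
  obtain C where C: "0 < C" "\<And>n. n \<ge> 1 \<Longrightarrow> M (n + 1) \<le> C ^ (n + 1) * M n"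
    using assms(1) by (auto simp: weight_sequence_def)
  obtain c1 c2 where c12: "0 < c1" "0 < c2"
    and upper: "\<And>n. n \<ge> 1 \<Longrightarrow> cmod (of_real (h (n - 1))) \<le> c1 * c2 ^ n * M n"
    using cls by (auto simp: fps_class_def)
  define E where "E = \<bar>ln c1\<bar> + 2 * \<bar>ln (c2 * C)\<bar> - ln c"
  \<comment> \<open>Membership in the class, with \<open>M (n + 1)\<close> traded for \<open>M n\<close> at a geometric cost.\<close>
  have g_upper: "ln (g n) \<le> real n * E + ln (M n)" if n: "n \<ge> 1" for n
  proof -
    have "g n \<ge> 1" by (rule g_ge_1)
    then have h_pos: "0 < h n" using c h_nonneg[of n] by (cases "h n = 0") (auto simp: g_def)
    have "h n \<le> c1 * c2 ^ (n + 1) * M (n + 1)" using upper[of "n + 1"] h_pos by simp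
    also have "\<dots> \<le> c1 * c2 ^ (n + 1) * (C ^ (n + 1) * M n)"
      using C(2)[OF n] c12 by (intro mult_left_mono) auto
    also have "\<dots> = c1 * (c2 * C) ^ (n + 1) * M n" by (simp add: power_mult_distrib)
    finally have "ln (h n) \<le> ln (c1 * (c2 * C) ^ (n + 1) * M n)"
      using h_pos by (intro ln_mono)
    also have "\<dots> = ln c1 + real (n + 1) * ln (c2 * C) + ln (M n)"
      using c12 C(1) M_pos[OF n] by (simp add: ln_mult ln_realpow del: power_Suc)
    also have "\<dots> \<le> real n * \<bar>ln c1\<bar> + (2 * real n) * \<bar>ln (c2 * C)\<bar> + ln (M n)"
    proof -
      have "1 * \<bar>ln c1\<bar> \<le> real n * \<bar>ln c1\<bar>" using n by (intro mult_right_mono) auto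
      moreover have "real (n + 1) * ln (c2 * C) \<le> (2 * real n) * \<bar>ln (c2 * C)\<bar>"
      proof -
        have "real (n + 1) * ln (c2 * C) \<le> real (n + 1) * \<bar>ln (c2 * C)\<bar>"
          by (intro mult_left_mono) auto
        also have "\<dots> \<le> (2 * real n) * \<bar>ln (c2 * C)\<bar>" using n by (intro mult_right_mono) auto
        finally show ?thesis .
      qed
      ultimately show ?thesis by linarith
    qed
    finally show ?thesis
      using h_pos c by (simp add: g_def E_def ln_div ln_realpow algebra_simps)
  qed
  define \<kappa> where "\<kappa> = ln (M 2) - 2 * ln (M 1)"
  define K where "K = loss_rate * inverse_t_total + E + 2 * \<bar>\<kappa>\<bar>"
  \<comment> \<open>Compare at the denominator \<open>p \<le> n\<close>, where the resonant lower bound is available, and move to \<open>n\<close> by convexity.\<close>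
  have bounded: "(\<Sum>j=0..k n. ln (real_of_int (cf_denom \<omega> (j + 1))) / real_of_int (cf_denom \<omega> j))
      - 1 / real n * ln (M n) \<le> K" if n: "n \<ge> 1" for n
  proof -
    define p where "p = q (k n)"
    have p: "1 \<le> p" "p \<le> n" using q_pos assms(4)[OF n] by (auto simp: p_def q_int)
    have "real p * (brjuno (Suc (k n)) - loss_rate * inverse_t_total) \<le> real p * E + ln (M p)"
      using ln_g_at_q[of "k n"] g_upper[of p] p by (simp add: p_def)
    then have "brjuno (Suc (k n)) - loss_rate * inverse_t_total \<le> (real p * E + ln (M p)) / real p"
      using p by (simp add: pos_le_divide_eq mult.commute)
    also have "\<dots> = E + (ln (M p) + \<kappa>) / real p - \<kappa> / real p"
      using p by (simp add: field_simps)
    also have "\<dots> \<le> E + (ln (M n) + \<kappa>) / real n - \<kappa> / real p"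
      using log_convex_ln_mean_mono[OF M_pos M_conv p] by (simp add: \<kappa>_def)
    also have "\<dots> = E + 1 / real n * ln (M n) + \<kappa> / real n - \<kappa> / real p"
      by (simp add: add_divide_distrib)
    also have "\<dots> \<le> E + 1 / real n * ln (M n) + 2 * \<bar>\<kappa>\<bar>"
    proof -
      have "\<bar>\<kappa> / real i\<bar> \<le> \<bar>\<kappa>\<bar>" if "1 \<le> i" for i
        using that by (simp add: abs_divide divide_le_eq mult_le_cancel_left1)
      from this[OF n] this[OF p(1)] show ?thesis by linarith
    qed
    finally have "brjuno (Suc (k n)) - 1 / real n * ln (M n) \<le> K" by (simp add: K_def)
    then show ?thesis
      by (simp add: brjuno_def q_int lessThan_Suc_atMost atMost_atLeast0)
  qed
  have "limsup (\<lambda>n. ereal ((\<Sum>j=0..k n. ln (real_of_int (cf_denom \<omega> (j + 1))) / real_of_int (cf_denom \<omega> j))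
                            - 1 / real n * ln (M n))) \<le> ereal K"
    by (intro Limsup_bounded eventually_sequentiallyI[of 1]) (use bounded in simp)
  then show False using assms(5) by simp
qed

end
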